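(* Let $T$ be a trigraph with $n$ vertices and $Z=(a_1,b_1,a_2,b_2)$ a proper $4$-tuple of $T$. There is an $O(n^2)$ time algorithm which, given a set $R_0\subseteq V(T)$ with $|R_0|\ge4$ and $R_0\cap\{a_1,b_1,a_2,b_2\}=\{a_1,b_1\}$, either outputs a weak fragment $X$ of $T$ compatible with $Z$ such that $R_0\subseteq X$, or outputs the true statement "there exists no weak fragment $X$ compatible with $Z$ such that $R_0\subseteq X$". Moreover, when $X$ is output, $X\subseteq X'$ for every weak fragment $X'$ of $T$ compatible with $Z$ with $R_0\subseteq X'$.
   Context: Trigraphs: finite $V(T)$ with $\theta:\binom{V(T)}{2}\to\{-1,0,1\}$; $u,v$ strongly adjacent if $\theta(uv)=1$, strongly antiadjacent if $\theta(uv)=-1$, a switchable pair if $\theta(uv)=0$. A vertex (set) is strongly complete (strongly anticomplete) to a set if strongly adjacent (strongly antiadjacent) to all its vertices. Weak fragment: $X\subseteq V(T)$ for which there are disjoint sets $A_1,B_1,C_1,D_1,A_2,B_2,C_2,D_2$ (a split for $X$) with $X=A_1\cup B_1\cup C_1\cup D_1$, $V(T)\setminus X=A_2\cup B_2\cup C_2\cup D_2$, $A_1$ strongly complete to $A_2\cup D_2$ and strongly anticomplete to $B_2\cup C_2$, $B_1$ strongly complete to $B_2\cup D_2$ and strongly anticomplete to $A_2\cup C_2$, $C_1$ strongly anticomplete to $A_2\cup B_2\cup C_2$, $D_1$ strongly complete to $A_2\cup B_2\cup D_2$, $|X|\ge4$, $|V(T)\setminus X|\ge4$, $|A_i|,|B_i|\ge1$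 for $i=1,2$, and at least one of: ($C_1=D_1=\emptyset$, $C_2\neq\emptyset$, $D_2\neq\emptyset$), or $D_1=D_2=\emptyset$, or $C_1=C_2=\emptyset$. A $4$-tuple $(a_1,b_1,a_2,b_2)$ of vertices is proper if the four vertices are pairwise distinct, $a_1a_2$ and $b_1b_2$ are strongly adjacent pairs, and $a_1b_2$ and $b_1a_2$ are strongly antiadjacent pairs. It is compatible with a weak fragment $X$ if there is a split $(A_1,B_1,C_1,D_1,A_2,B_2,C_2,D_2)$ for $X$ with $a_1\in A_1$, $b_1\in B_1$, $a_2\in A_2$, $b_2\in B_2$. *)

theory Defs
  imports Complex_Main "HOL-Library.Landau_Symbols"
begin

section \<open>Trigraphs, weak fragments and proper 4-tuples\<close>

text \<open>The adjacency function lives on unordered pairs; its value on sets that are not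
  2-element subsets of the vertex set is irrelevant.\<close>

record 'a trigraph =
  verts :: "'a set"
  theta :: "'a set \<Rightarrow> int"

definition trigraph :: "'a trigraph \<Rightarrow> bool" where
  "trigraph T \<longleftrightarrow> finite (verts T) \<and>
     (\<forall>e. e \<subseteq> verts T \<and> card e = 2 \<longrightarrow> theta T e \<in> {-1, 0, 1})"

definition strongly_adjacent :: "'a trigraph \<Rightarrow> 'a \<Rightarrow> 'a \<Rightarrow> bool" where
  "strongly_adjacent T u v \<longleftrightarrow>
     u \<in> verts T \<and> v \<in> verts T \<and> u \<noteq> v \<and> theta T {u, v} = 1"

definition strongly_antiadjacent :: "'a trigraph \<Rightarrow> 'a \<Rightarrow> 'a \<Rightarrow> bool" where
  "strongly_antiadjacent T u v \<longleftrightarrow>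
     u \<in> verts T \<and> v \<in> verts T \<and> u \<noteq> v \<and> theta T {u, v} = -1"

definition strongly_complete :: "'a trigraph \<Rightarrow> 'a set \<Rightarrow> 'a set \<Rightarrow> bool" where
  "strongly_complete T A B \<longleftrightarrow> (\<forall>a\<in>A. \<forall>b\<in>B. strongly_adjacent T a b)"

definition strongly_anticomplete :: "'a trigraph \<Rightarrow> 'a set \<Rightarrow> 'a set \<Rightarrow> bool" where
  "strongly_anticomplete T A B \<longleftrightarrow> (\<forall>a\<in>A. \<forall>b\<in>B. strongly_antiadjacent T a b)"

definition is_split :: "'a trigraph \<Rightarrow> 'a set \<Rightarrow>
    'a set \<Rightarrow> 'a set \<Rightarrow> 'a set \<Rightarrow> 'a set \<Rightarrow> 'a set \<Rightarrow> 'a set \<Rightarrow> 'a set \<Rightarrow> 'a set \<Rightarrow> bool" where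
  "is_split T X A1 B1 C1 D1 A2 B2 C2 D2 \<longleftrightarrow>
     X \<subseteq> verts T \<and>
     sorted_wrt disjnt [A1, B1, C1, D1, A2, B2, C2, D2] \<and>
     X = A1 \<union> B1 \<union> C1 \<union> D1 \<and>
     verts T - X = A2 \<union> B2 \<union> C2 \<union> D2 \<and>
     strongly_complete T A1 (A2 \<union> D2) \<and> strongly_anticomplete T A1 (B2 \<union> C2) \<and>
     strongly_complete T B1 (B2 \<union> D2) \<and> strongly_anticomplete T B1 (A2 \<union> C2) \<and>
     strongly_anticomplete T C1 (A2 \<union> B2 \<union> C2) \<and>
     strongly_complete T D1 (A2 \<union> B2 \<union> D2) \<and>
     card X \<ge> 4 \<and> card (verts T - X) \<ge> 4 \<and>
     card A1 \<ge> 1 \<and> card B1 \<ge> 1 \<and> card A2 \<ge> 1 \<and> card B2 \<ge> 1 \<and>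
     ((C1 = {} \<and> D1 = {} \<and> C2 \<noteq> {} \<and> D2 \<noteq> {}) \<or>
      (D1 = {} \<and> D2 = {}) \<or>
      (C1 = {} \<and> C2 = {}))"

definition weak_fragment :: "'a trigraph \<Rightarrow> 'a set \<Rightarrow> bool" where
  "weak_fragment T X \<longleftrightarrow>
     (\<exists>A1 B1 C1 D1 A2 B2 C2 D2. is_split T X A1 B1 C1 D1 A2 B2 C2 D2)"

definition proper :: "'a trigraph \<Rightarrow> 'a \<times> 'a \<times> 'a \<times> 'a \<Rightarrow> bool" where
  "proper T Z \<longleftrightarrow> (case Z of (a1, b1, a2, b2) \<Rightarrow>
     {a1, b1, a2, b2} \<subseteq> verts T \<and> distinct [a1, b1, a2, b2] \<and>
     strongly_adjacent T a1 a2 \<and> strongly_adjacent T b1 b2 \<and>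
     strongly_antiadjacent T a1 b2 \<and> strongly_antiadjacent T b1 a2)"

definition compatible :: "'a trigraph \<Rightarrow> 'a \<times> 'a \<times> 'a \<times> 'a \<Rightarrow> 'a set \<Rightarrow> bool" where
  "compatible T Z X \<longleftrightarrow> (case Z of (a1, b1, a2, b2) \<Rightarrow>
     \<exists>A1 B1 C1 D1 A2 B2 C2 D2. is_split T X A1 B1 C1 D1 A2 B2 C2 D2 \<and>
       a1 \<in> A1 \<and> b1 \<in> B1 \<and> a2 \<in> A2 \<and> b2 \<in> B2)"


section \<open>A word RAM with running times\<close>

text \<open>
  Programs are structured programs over finitely many registers and a random access memory.
  Every operation and every control step costs one unit of time. All words handled by a program
  (constants, values, addresses) must be smaller than a word limit \<open>W\<close>; otherwise the computation
  faults, i.e. has no final state. With \<open>W = n ^ k\<close> for inputs of size \<open>n\<close> this is the usual word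
  RAM with words of \<open>O(log n)\<close> bits, so that unit cost arithmetic cannot be abused to
  manipulate large objects in a single step.
\<close>

datatype exp =
    Const nat
  | Reg nat
  | Load exp
  | Plus exp exp
  | Minus exp exp
  | Times exp exp
  | Less exp exp
  | Equal exp exp

datatype com =
    Skip
  | Assign nat exp
  | Store exp exp
  | Seq com com
  | If exp com com
  | While exp com

record state =
  regs :: "nat \<Rightarrow> nat"
  mem :: "nat \<Rightarrow> nat"

definition word :: "nat \<Rightarrow> nat \<Rightarrow> nat option" where
  "word W x = (if x < W then Some x else None)"

definition binop :: "nat \<Rightarrow> (nat \<Rightarrow> nat \<Rightarrow> nat) \<Rightarrow> nat option \<Rightarrow> nat option \<Rightarrow> nat option" where
  "binop W f x y = Option.bind x (\<lambda>a. Option.bind y (\<lambda>b. word W (f a b)))"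

fun eval :: "nat \<Rightarrow> exp \<Rightarrow> state \<Rightarrow> nat option" where
  "eval W (Const c) s = word W c"
| "eval W (Reg r) s = word W (regs s r)"
| "eval W (Load e) s = Option.bind (eval W e s) (\<lambda>a. word W (mem s a))"
| "eval W (Plus e f) s = binop W (+) (eval W e s) (eval W f s)"
| "eval W (Minus e f) s = binop W (-) (eval W e s) (eval W f s)"
| "eval W (Times e f) s = binop W (*) (eval W e s) (eval W f s)"
| "eval W (Less e f) s = binop W (\<lambda>a b. of_bool (a < b)) (eval W e s) (eval W f s)"
| "eval W (Equal e f) s = binop W (\<lambda>a b. of_bool (a = b)) (eval W e s) (eval W f s)"

fun cost :: "exp \<Rightarrow> nat" where
  "cost (Const c) = 1"
| "cost (Reg r) = 1"
| "cost (Load e) = 1 + cost e"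
| "cost (Plus e f) = 1 + cost e + cost f"
| "cost (Minus e f) = 1 + cost e + cost f"
| "cost (Times e f) = 1 + cost e + cost f"
| "cost (Less e f) = 1 + cost e + cost f"
| "cost (Equal e f) = 1 + cost e + cost f"

text \<open>\<open>exec W P s t s'\<close>: with word limit \<open>W\<close>, program \<open>P\<close> started in state \<open>s\<close> terminates
  without fault in state \<open>s'\<close> after exactly \<open>t\<close> time units.\<close>

inductive exec :: "nat \<Rightarrow> com \<Rightarrow> state \<Rightarrow> nat \<Rightarrow> state \<Rightarrow> bool" for W :: nat where
  Skip: "exec W Skip s 1 s"
| Assign: "eval W e s = Some x \<Longrightarrow>
    exec W (Assign r e) s (1 + cost e) (s\<lparr>regs := (regs s)(r := x)\<rparr>)"
| Store: "eval W e s = Some a \<Longrightarrow> eval W f s = Some x \<Longrightarrow>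
    exec W (Store e f) s (1 + cost e + cost f) (s\<lparr>mem := (mem s)(a := x)\<rparr>)"
| Seq: "exec W P s t s' \<Longrightarrow> exec W Q s' u s'' \<Longrightarrow> exec W (Seq P Q) s (t + u) s''"
| IfTrue: "eval W e s = Some x \<Longrightarrow> x \<noteq> 0 \<Longrightarrow> exec W P s t s' \<Longrightarrow>
    exec W (If e P Q) s (1 + cost e + t) s'"
| IfFalse: "eval W e s = Some 0 \<Longrightarrow> exec W Q s t s' \<Longrightarrow>
    exec W (If e P Q) s (1 + cost e + t) s'"
| WhileTrue: "eval W e s = Some x \<Longrightarrow> x \<noteq> 0 \<Longrightarrow> exec W P s t s' \<Longrightarrow>
    exec W (While e P) s' u s'' \<Longrightarrow> exec W (While e P) s (1 + cost e + t + u) s''"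
| WhileFalse: "eval W e s = Some 0 \<Longrightarrow> exec W (While e P) s (1 + cost e) s"

inductive_cases exec_SkipE: "exec W Skip s t s'"
inductive_cases exec_AssignE: "exec W (Assign r e) s t s'"
inductive_cases exec_StoreE: "exec W (Store e f) s t s'"
inductive_cases exec_SeqE: "exec W (Seq P Q) s t s'"
inductive_cases exec_IfE: "exec W (If e P Q) s t s'"
inductive_cases exec_WhileE: "exec W (While e P) s t s'"

lemma exec_deterministic:
  "exec W P s t s' \<Longrightarrow> exec W P s u s'' \<Longrightarrow> u = t \<and> s'' = s'"
proof (induction arbitrary: u s'' rule: exec.induct)
  case (Skip s)
  then show ?case by (auto elim: exec_SkipE)
next
  case (Assign e s x r)
  then show ?case by (auto elim: exec_AssignE)
next
  case (Store e s a f x)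
  then show ?case by (auto elim: exec_StoreE)
next
  case (Seq P s t s' Q u' s1)
  from Seq.prems obtain p q m where pq: "exec W P s p m" "exec W Q m q s''" "u = p + q"
    by (elim exec_SeqE) simp
  from Seq.IH(1)[OF pq(1)] pq(2) have "exec W Q s' q s''" by simp
  from Seq.IH(2)[OF this] Seq.IH(1)[OF pq(1)] pq(3) show ?case by simp
next
  case (IfTrue e s x P t s' Q)
  from IfTrue.prems obtain p where "exec W P s p s''" "u = 1 + cost e + p"
    by (rule exec_IfE) (use IfTrue.hyps in simp_all)
  with IfTrue.IH show ?case by simp
next
  case (IfFalse e s Q t s' P)
  from IfFalse.prems obtain p where "exec W Q s p s''" "u = 1 + cost e + p"
    by (rule exec_IfE) (use IfFalse.hyps in simp_all)
  with IfFalse.IH show ?case by simp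
next
  case (WhileTrue e s x P t s' u' s1)
  from WhileTrue.prems obtain p q m where pq: "exec W P s p m" "exec W (While e P) m q s''"
      "u = 1 + cost e + p + q"
    by (rule exec_WhileE) (use WhileTrue.hyps in simp_all)
  from WhileTrue.IH(1)[OF pq(1)] pq(2) have "exec W (While e P) s' q s''" by simp
  from WhileTrue.IH(2)[OF this] WhileTrue.IH(1)[OF pq(1)] pq(3) show ?case by simp
next
  case (WhileFalse e s P)
  from WhileFalse.prems show ?case by (rule exec_WhileE) (use WhileFalse.hyps in auto)
qed


section \<open>Input and output conventions\<close>

text \<open>
  A trigraph with \<open>n\<close> vertices is given by its adjacency matrix with respect to a numbering
  \<open>\<nu>\<close> of its vertices by \<open>0, \<dots>, n - 1\<close>. Register 0 holds \<open>n\<close>, registers 1 to 4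
  hold the numbers of the vertices of \<open>Z\<close>. Cell \<open>i * n + j\<close> holds the entry for the
  \<open>i\<close>-th and \<open>j\<close>-th vertex, with the values \<open>-1, 0, 1\<close> encoded as \<open>0, 1, 2\<close> (and \<open>0\<close> on the
  diagonal). Cells \<open>n\<^sup>2, \<dots>, n\<^sup>2 + n - 1\<close> hold the characteristic vector of \<open>R0\<close>.
  All other registers and cells are \<open>0\<close>.
\<close>

definition matrix_entry :: "'a trigraph \<Rightarrow> 'a \<Rightarrow> 'a \<Rightarrow> nat" where
  "matrix_entry T u v = (if u = v then 0 else nat (theta T {u, v} + 1))"

definition input_state ::
    "'a trigraph \<Rightarrow> (nat \<Rightarrow> 'a) \<Rightarrow> 'a \<times> 'a \<times> 'a \<times> 'a \<Rightarrow> 'a set \<Rightarrow> state" where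
  "input_state T \<nu> Z R0 =
    (let n = card (verts T); num = inv_into {..<n} \<nu> in
     case Z of (a1, b1, a2, b2) \<Rightarrow>
       \<lparr>regs = (\<lambda>r. if r < 5 then [n, num a1, num b1, num a2, num b2] ! r else 0),
        mem = (\<lambda>c. if c < n * n then matrix_entry T (\<nu> (c div n)) (\<nu> (c mod n))
                   else if c < n * n + n \<and> \<nu> (c - n * n) \<in> R0 then 1 else 0)\<rparr>)"

text \<open>At the end, register 0 holds \<open>1\<close> if a set is output and \<open>0\<close> if the output is the
  negative statement. In the first case the output set is given by its characteristic vector in
  cells \<open>n\<^sup>2, \<dots>, n\<^sup>2 + n - 1\<close>.\<close>

definition output_set :: "'a trigraph \<Rightarrow> (nat \<Rightarrow> 'a) \<Rightarrow> state \<Rightarrow> 'a set" where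
  "output_set T \<nu> s =
    (let n = card (verts T) in {\<nu> i | i. i < n \<and> mem s (n * n + i) = 1})"

end

theory Submission
  imports Defs
begin

text \<open>
  In a split compatible with \<open>(a\<^sub>1, b\<^sub>1, a\<^sub>2, b\<^sub>2)\<close> the part of a vertex of \<open>X\<close> is determined by its
  adjacency to \<open>a\<^sub>2, b\<^sub>2\<close>, and the part of a vertex outside \<open>X\<close> by its adjacency to \<open>a\<^sub>1, b\<^sub>1\<close>.
  The adjacency requirements, and also the exclusion of \<open>C\<^sub>1\<close> together with \<open>D\<^sub>2\<close> and of \<open>D\<^sub>1\<close>
  together with \<open>C\<^sub>2\<close>, then become a condition on single pairs \<open>(x, y)\<close> with \<open>x \<in> X\<close> and \<open>y \<notin> X\<close>.
  So \<open>X\<close> must be closed under the relation ``\<open>y\<close> does not fit \<open>x\<close>'', and the least candidate is the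
  set reachable from \<open>R\<^sub>0\<close>. All remaining conditions (\<open>a\<^sub>2, b\<^sub>2 \<notin> X\<close>, at least four vertices
  outside \<open>X\<close>, not both \<open>C\<^sub>1\<close> and \<open>D\<^sub>1\<close> nonempty) are inherited by subsets, so if the reachable set
  violates one of them there is no solution. A search with a queue examines each pair at most once.
\<close>

section \<open>Compatible sets as closed sets\<close>

text \<open>\<open>M\<close> is an adjacency matrix with entries 0, 1, 2 for strongly antiadjacent, switchable and
  strongly adjacent pairs. The negated conjunct rules out that \<open>x\<close> lies in \<open>C\<^sub>1\<close> and \<open>y\<close> in \<open>D\<^sub>2\<close>,
  or \<open>x\<close> in \<open>D\<^sub>1\<close> and \<open>y\<close> in \<open>C\<^sub>2\<close>.\<close>

definition fits :: "('b \<Rightarrow> 'b \<Rightarrow> nat) \<Rightarrow> 'b \<Rightarrow> 'b \<Rightarrow> 'b \<Rightarrow> 'b \<Rightarrow> 'b \<Rightarrow> 'b \<Rightarrow> bool" where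
  "fits M a1 b1 a2 b2 x y \<longleftrightarrow>
     M x a2 \<noteq> 1 \<and> M x b2 \<noteq> 1 \<and> M a1 y \<noteq> 1 \<and> M b1 y \<noteq> 1 \<and>
     \<not> (M x a2 = M x b2 \<and> M a1 y = M b1 y \<and> M x a2 \<noteq> M a1 y) \<and>
     M x y = (if M x a2 = 2 \<and> M a1 y = 2 \<or> M x b2 = 2 \<and> M b1 y = 2 then 2 else 0)"

text \<open>The disjunction that ends \<open>is_split\<close> is equivalent to three conditions: C1
  or D2 is empty, D1 or C2 is empty, C1 or D1 is empty. The first two concern pairs across the cut
  and go into \<open>fits\<close>; this formula is the violation of the third, which concerns X
  alone.\<close>

definition meets_C1_D1 :: "('b \<Rightarrow> 'b \<Rightarrow> nat) \<Rightarrow> 'b \<Rightarrow> 'b \<Rightarrow> 'b set \<Rightarrow> bool" where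
  "meets_C1_D1 M a2 b2 X \<longleftrightarrow>
     (\<exists>x\<in>X. M x a2 = 0 \<and> M x b2 = 0) \<and> (\<exists>x\<in>X. M x a2 = 2 \<and> M x b2 = 2)"

section \<open>Matrix entries and strong adjacency\<close>

lemma theta_cases:
  assumes "trigraph T" "u \<in> verts T" "v \<in> verts T" "u \<noteq> v"
  shows "theta T {u, v} \<in> {-1, 0, 1}"
proof -
  have "{u, v} \<subseteq> verts T \<and> card {u, v} = 2" using assms by simp
  then show ?thesis using assms(1) unfolding trigraph_def by metis
qed

lemma matrix_entry_cases:
  assumes "trigraph T" "u \<in> verts T" "v \<in> verts T"
  shows "matrix_entry T u v \<in> {0, 1, 2}"
  using theta_cases[OF assms] by (auto simp: matrix_entry_def)

lemma strongly_adjacent_iff_matrix_entry: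
  assumes "u \<in> verts T" "v \<in> verts T" "u \<noteq> v"
  shows "strongly_adjacent T u v \<longleftrightarrow> matrix_entry T u v = 2"
  using assms by (auto simp: strongly_adjacent_def matrix_entry_def)

lemma strongly_antiadjacent_iff_matrix_entry:
  assumes "trigraph T" "u \<in> verts T" "v \<in> verts T" "u \<noteq> v"
  shows "strongly_antiadjacent T u v \<longleftrightarrow> matrix_entry T u v = 0"
  using assms theta_cases[OF assms] by (auto simp: strongly_antiadjacent_def matrix_entry_def)

lemma matrix_entry_strongly_adjacent: "strongly_adjacent T u v \<Longrightarrow> matrix_entry T u v = 2"
  by (simp add: strongly_adjacent_def matrix_entry_def)

lemma matrix_entry_strongly_antiadjacent: "strongly_antiadjacent T u v \<Longrightarrow> matrix_entry T u v = 0"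
  by (simp add: strongly_antiadjacent_def matrix_entry_def)

text \<open>Since a2 lies in A2 and b2 in B2, the entries of x against a2 and b2 identify the part
  of x; likewise a1 and b1 identify the part of y outside X. This turns each condition on parts into
  one on entries.\<close>

lemma compatible_imp_closed:
  assumes "compatible T (a1, b1, a2, b2) X"
  defines "M \<equiv> matrix_entry T"
  shows "X \<subseteq> verts T" "a2 \<notin> X" "b2 \<notin> X" "card (verts T - X) \<ge> 4"
    and "\<And>x y. x \<in> X \<Longrightarrow> y \<in> verts T - X \<Longrightarrow> fits M a1 b1 a2 b2 x y"
    and "\<not> meets_C1_D1 M a2 b2 X"
proof -
  obtain A1 B1 C1 D1 A2 B2 C2 D2 where
    sp: "is_split T X A1 B1 C1 D1 A2 B2 C2 D2" and
    Z: "a1 \<in> A1" "b1 \<in> B1" "a2 \<in> A2" "b2 \<in> B2"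
    using assms(1) by (auto simp: compatible_def)
  have X: "X = A1 \<union> B1 \<union> C1 \<union> D1" and Y: "verts T - X = A2 \<union> B2 \<union> C2 \<union> D2"
    using sp unfolding is_split_def by blast+
  show "X \<subseteq> verts T" "card (verts T - X) \<ge> 4" using sp unfolding is_split_def by blast+
  show "a2 \<notin> X" "b2 \<notin> X" using Z Y by blast+
  have adj: "M x y = 2"
    if "x \<in> A1 \<and> y \<in> A2 \<union> D2 \<or> x \<in> B1 \<and> y \<in> B2 \<union> D2 \<or> x \<in> D1 \<and> y \<in> A2 \<union> B2 \<union> D2" for x y
    using sp that unfolding is_split_def strongly_complete_def M_def
    by (intro matrix_entry_strongly_adjacent) blast
  have anti: "M x y = 0"
    if "x \<in> A1 \<and> y \<in> B2 \<union> C2 \<or> x \<in> B1 \<and> y \<in> A2 \<union> C2 \<or> x \<in> C1 \<and> y \<in> A2 \<union> B2 \<union> C2" for x y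
    using sp that unfolding is_split_def strongly_anticomplete_def M_def
    by (intro matrix_entry_strongly_antiadjacent) blast
  have one: "x \<in> A1 \<and> M x a2 = 2 \<and> M x b2 = 0 \<or> x \<in> B1 \<and> M x a2 = 0 \<and> M x b2 = 2 \<or>
      x \<in> C1 \<and> M x a2 = 0 \<and> M x b2 = 0 \<or> x \<in> D1 \<and> M x a2 = 2 \<and> M x b2 = 2"
    if "x \<in> X" for x using that X adj anti Z by blast
  have two: "y \<in> A2 \<and> M a1 y = 2 \<and> M b1 y = 0 \<or> y \<in> B2 \<and> M a1 y = 0 \<and> M b1 y = 2 \<or>
      y \<in> C2 \<and> M a1 y = 0 \<and> M b1 y = 0 \<or> y \<in> D2 \<and> M a1 y = 2 \<and> M b1 y = 2"
    if "y \<in> verts T - X" for y using that Y adj anti Z by blast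
  have cases: "C1 = {} \<and> D1 = {} \<or> D1 = {} \<and> D2 = {} \<or> C1 = {} \<and> C2 = {}"
    using sp unfolding is_split_def by blast
  show "\<not> meets_C1_D1 M a2 b2 X"
    using cases one unfolding meets_C1_D1_def by fastforce
  fix x y assume xy: "x \<in> X" "y \<in> verts T - X"
  show "fits M a1 b1 a2 b2 x y"
    using one[OF xy(1)]
  proof (elim disjE conjE)
    assume x: "x \<in> A1" "M x a2 = 2" "M x b2 = 0"
    show ?thesis using two[OF xy(2)] x adj[of x y] anti[of x y] unfolding fits_def by auto
  next
    assume x: "x \<in> B1" "M x a2 = 0" "M x b2 = 2"
    show ?thesis using two[OF xy(2)] x adj[of x y] anti[of x y] unfolding fits_def by auto
  next
    assume x: "x \<in> C1" "M x a2 = 0" "M x b2 = 0"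
    then have "D2 = {}" using cases by blast
    with x show ?thesis using two[OF xy(2)] anti[of x y] unfolding fits_def by auto
  next
    assume x: "x \<in> D1" "M x a2 = 2" "M x b2 = 2"
    then have "C2 = {}" using cases by blast
    with x show ?thesis using two[OF xy(2)] adj[of x y] unfolding fits_def by auto
  qed
qed

text \<open>For the converse the parts are defined by these entry patterns. \<open>fits\<close>
  excludes the entry 1, so the patterns cover X and its complement, and its last conjunct supplies
  the completeness and anticompleteness required of a split.\<close>

lemma closed_imp_compatible:
  assumes T: "trigraph T" and Z: "proper T (a1, b1, a2, b2)"
  defines "M \<equiv> matrix_entry T"
  assumes X: "X \<subseteq> verts T" "a1 \<in> X" "b1 \<in> X" "a2 \<notin> X" "b2 \<notin> X"
    and cards: "card X \<ge> 4" "card (verts T - X) \<ge> 4"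
    and fits: "\<And>x y. x \<in> X \<Longrightarrow> y \<in> verts T - X \<Longrightarrow> fits M a1 b1 a2 b2 x y"
    and both: "\<not> meets_C1_D1 M a2 b2 X"
  shows "compatible T (a1, b1, a2, b2) X"
proof -
  define A1 B1 C1 D1 where
    "A1 = {x \<in> X. M x a2 = 2 \<and> M x b2 = 0}" and "B1 = {x \<in> X. M x a2 = 0 \<and> M x b2 = 2}" and
    "C1 = {x \<in> X. M x a2 = 0 \<and> M x b2 = 0}" and "D1 = {x \<in> X. M x a2 = 2 \<and> M x b2 = 2}"
  note one = this
  define A2 B2 C2 D2 where
    "A2 = {y \<in> verts T - X. M a1 y = 2 \<and> M b1 y = 0}" and
    "B2 = {y \<in> verts T - X. M a1 y = 0 \<and> M b1 y = 2}" and
    "C2 = {y \<in> verts T - X. M a1 y = 0 \<and> M b1 y = 0}" and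
    "D2 = {y \<in> verts T - X. M a1 y = 2 \<and> M b1 y = 2}"
  note two = this
  have V: "a1 \<in> verts T" "b1 \<in> verts T" "a2 \<in> verts T" "b2 \<in> verts T"
    and Ms: "M a1 a2 = 2" "M b1 b2 = 2" "M a1 b2 = 0" "M b1 a2 = 0"
    using Z by (auto simp: proper_def M_def matrix_entry_strongly_adjacent
        matrix_entry_strongly_antiadjacent)
  have mem: "a1 \<in> A1" "b1 \<in> B1" "a2 \<in> A2" "b2 \<in> B2"
    using V Ms X unfolding one two by auto
  have entry: "M u v \<in> {0, 1, 2}" if "u \<in> verts T" "v \<in> verts T" for u v
    using matrix_entry_cases[OF T that] by (simp add: M_def)
  have Xeq: "X = A1 \<union> B1 \<union> C1 \<union> D1"
  proof (intro set_eqI iffI)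
    fix x assume x: "x \<in> X"
    \<comment> \<open>The first two conjuncts of \<open>fits\<close> do not mention y, so any vertex
      outside X serves as y; a2 is one.\<close>
    have "M x a2 \<noteq> 1" "M x b2 \<noteq> 1"
      using fits[OF x, of a2] V X unfolding fits_def by auto
    then show "x \<in> A1 \<union> B1 \<union> C1 \<union> D1"
      using entry[of x a2] entry[of x b2] x X V unfolding one by auto
  qed (auto simp: one)
  have Yeq: "verts T - X = A2 \<union> B2 \<union> C2 \<union> D2"
  proof (intro set_eqI iffI)
    fix y assume y: "y \<in> verts T - X"
    have "M a1 y \<noteq> 1" "M b1 y \<noteq> 1"
      using fits[of a1 y] y X unfolding fits_def by auto
    then show "y \<in> A2 \<union> B2 \<union> C2 \<union> D2"
      using entry[of a1 y] entry[of b1 y] y V unfolding two by auto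
  qed (auto simp: two)
  have adj: "strongly_adjacent T x y" if "x \<in> X" "y \<in> verts T - X" "M x y = 2" for x y
    using that X strongly_adjacent_iff_matrix_entry[of x T y] unfolding M_def by blast
  have anti: "strongly_antiadjacent T x y" if "x \<in> X" "y \<in> verts T - X" "M x y = 0" for x y
    using that X strongly_antiadjacent_iff_matrix_entry[OF T, of x y] unfolding M_def by blast
  have complete: "strongly_complete T A1 (A2 \<union> D2)" "strongly_complete T B1 (B2 \<union> D2)"
    "strongly_complete T D1 (A2 \<union> B2 \<union> D2)"
    unfolding strongly_complete_def
    by (intro ballI adj; use fits in \<open>fastforce simp: one two fits_def\<close>)+
  have anticomplete: "strongly_anticomplete T A1 (B2 \<union> C2)"
    "strongly_anticomplete T B1 (A2 \<union> C2)" "strongly_anticomplete T C1 (A2 \<union> B2 \<union> C2)"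
    unfolding strongly_anticomplete_def
    by (intro ballI anti; use fits in \<open>fastforce simp: one two fits_def\<close>)+
  \<comment> \<open>A vertex of C1 and one of D2 would have the constant patterns 0 and 2, which the
    negated conjunct of \<open>fits\<close> forbids; D1 and C2 are symmetric.\<close>
  have CD: "C1 = {} \<or> D2 = {}" "D1 = {} \<or> C2 = {}"
    using fits unfolding one two fits_def by fastforce+
  have "C1 = {} \<or> D1 = {}"
    using both unfolding meets_C1_D1_def one by blast
  with CD have shape: "C1 = {} \<and> D1 = {} \<and> C2 \<noteq> {} \<and> D2 \<noteq> {} \<or> D1 = {} \<and> D2 = {} \<or> C1 = {} \<and> C2 = {}"
    by blast
  have disj: "sorted_wrt disjnt [A1, B1, C1, D1, A2, B2, C2, D2]"
    by (auto simp: one two disjnt_iff)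
  have "finite (verts T)" using T by (simp add: trigraph_def)
  then have fin: "finite X" "finite (verts T - X)" using X finite_subset by auto
  have ge1: "card S \<ge> 1" if "s \<in> S" "finite S" for s and S :: "'a set"
    using that by (auto simp: Suc_le_eq card_gt_0_iff)
  have "card A1 \<ge> 1" "card B1 \<ge> 1" "card A2 \<ge> 1" "card B2 \<ge> 1"
    by (rule ge1[OF mem(1)] ge1[OF mem(2)] ge1[OF mem(3)] ge1[OF mem(4)];
        use fin in \<open>simp add: one two\<close>)+
  then have "is_split T X A1 B1 C1 D1 A2 B2 C2 D2"
    unfolding is_split_def
    using X(1) disj Xeq Yeq complete anticomplete cards shape by blast
  with mem show ?thesis unfolding compatible_def by blast
qed

lemma compatible_imp_weak_fragment: "compatible T Z X \<Longrightarrow> weak_fragment T X"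
  unfolding compatible_def weak_fragment_def by (cases Z) (simp, blast)

section \<open>Time bounded total correctness\<close>

text \<open>The state comes last so that \<open>runs W P B Q\<close> is itself a state predicate and
  can be the postcondition of the preceding command. As \<open>exec\<close> is deterministic, the
  existential claim describes the only run.\<close>

definition runs :: "nat \<Rightarrow> com \<Rightarrow> nat \<Rightarrow> (state \<Rightarrow> bool) \<Rightarrow> state \<Rightarrow> bool" where
  "runs W P B Q s \<longleftrightarrow> (\<exists>t s'. exec W P s t s' \<and> t \<le> B \<and> Q s')"

lemma runs_mono:
  "runs W P B Q s \<Longrightarrow> B \<le> B' \<Longrightarrow> (\<And>s'. Q s' \<Longrightarrow> Q' s') \<Longrightarrow> runs W P B' Q' s"
  unfolding runs_def using order_trans by blast

lemma runs_Skip: "Q s \<Longrightarrow> 1 \<le> B \<Longrightarrow> runs W Skip B Q s"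
  unfolding runs_def using exec.Skip by blast

lemma runs_Assign:
  "eval W e s = Some x \<Longrightarrow> Q (s\<lparr>regs := (regs s)(r := x)\<rparr>) \<Longrightarrow> 1 + cost e \<le> B \<Longrightarrow>
   runs W (Assign r e) B Q s"
  unfolding runs_def using exec.Assign by blast

lemma runs_Store:
  "eval W e s = Some a \<Longrightarrow> eval W f s = Some x \<Longrightarrow> Q (s\<lparr>mem := (mem s)(a := x)\<rparr>) \<Longrightarrow>
   1 + cost e + cost f \<le> B \<Longrightarrow> runs W (Store e f) B Q s"
  unfolding runs_def using exec.Store by blast

lemma runs_Seq:
  assumes "runs W P B (runs W P' B' Q) s" "B + B' \<le> B''"
  shows "runs W (Seq P P') B'' Q s"
proof -
  obtain t s1 u s2 where "exec W P s t s1" "t \<le> B" "exec W P' s1 u s2" "u \<le> B'" "Q s2"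
    using assms(1) unfolding runs_def by blast
  with exec.Seq[of W P s t s1 P' u s2] assms(2) show ?thesis
    unfolding runs_def by (intro exI[of _ "t + u"] exI[of _ s2]) auto
qed

lemma runs_If:
  assumes "eval W e s = Some x" "x \<noteq> 0 \<Longrightarrow> runs W P B Q s" "x = 0 \<Longrightarrow> runs W P' B Q s"
    and "1 + cost e + B \<le> B'"
  shows "runs W (If e P P') B' Q s"
proof (cases "x = 0")
  case True
  then obtain t s' where "exec W P' s t s'" "t \<le> B" "Q s'"
    using assms(3) unfolding runs_def by blast
  with exec.IfFalse[of W e s P' t s' P] True assms(1,4) show ?thesis
    unfolding runs_def by (intro exI[of _ "1 + cost e + t"] exI[of _ s']) auto
next
  case False
  then obtain t s' where "exec W P s t s'" "t \<le> B" "Q s'"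
    using assms(2) unfolding runs_def by blast
  with exec.IfTrue[of W e s x P t s' P'] False assms(1,4) show ?thesis
    unfolding runs_def by (intro exI[of _ "1 + cost e + t"] exI[of _ s']) auto
qed

text \<open>The variant f bounds the number of rounds, each paying for one test and one body; the
  last summand pays for the failing test. Each step also has to show that the test evaluates without
  fault.\<close>

lemma runs_While:
  assumes "I s"
    and step: "\<And>s. I s \<Longrightarrow> \<exists>x. eval W e s = Some x \<and>
      (x \<noteq> 0 \<longrightarrow> runs W P B (\<lambda>s'. I s' \<and> f s' < f s) s) \<and> (x = 0 \<longrightarrow> Q s)"
    and "f s * (1 + cost e + B) + 1 + cost e \<le> B'"
  shows "runs W (While e P) B' Q s"
proof -
  have "runs W (While e P) (f s * (1 + cost e + B) + 1 + cost e) Q s"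
    using assms(1)
  proof (induction "f s" arbitrary: s rule: less_induct)
    case less
    from step[OF less.prems] obtain x where x: "eval W e s = Some x"
      "x \<noteq> 0 \<Longrightarrow> runs W P B (\<lambda>s'. I s' \<and> f s' < f s) s" "x = 0 \<Longrightarrow> Q s" by blast
    show ?case
    proof (cases "x = 0")
      case True
      then have "exec W (While e P) s (1 + cost e) s" using x(1) exec.WhileFalse by simp
      moreover have "1 + cost e \<le> f s * (1 + cost e + B) + 1 + cost e" by simp
      ultimately show ?thesis unfolding runs_def using x(3)[OF True] by blast
    next
      case False
      with x(2) obtain t s1 where s1: "exec W P s t s1" "t \<le> B" "I s1" "f s1 < f s"
        unfolding runs_def by blast
      from less.hyps[OF s1(4,3)] obtain u s2 where s2: "exec W (While e P) s1 u s2"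
        "u \<le> f s1 * (1 + cost e + B) + 1 + cost e" "Q s2" unfolding runs_def by blast
      \<comment> \<open>The round just executed is paid for by the drop of f by at least
        one.\<close>
      have "Suc (f s1) * (1 + cost e + B) \<le> f s * (1 + cost e + B)"
        using s1(4) by (intro mult_right_mono) auto
      then have "1 + cost e + t + u \<le> f s * (1 + cost e + B) + 1 + cost e"
        using s1(2) s2(2) by simp
      moreover have "exec W (While e P) s (1 + cost e + t + u) s2"
        using exec.WhileTrue[OF x(1) False s1(1) s2(1)] .
      ultimately show ?thesis unfolding runs_def using s2(3) by blast
    qed
  qed
  with assms(3) show ?thesis by (auto intro: runs_mono)
qed

section \<open>The closure program\<close>

abbreviation conj_exp :: "exp \<Rightarrow> exp \<Rightarrow> exp" where
  "conj_exp \<equiv> Times"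

abbreviation disj_exp :: "exp \<Rightarrow> exp \<Rightarrow> exp" where
  "disj_exp e f \<equiv> Less (Const 0) (Plus e f)"

abbreviation neg_exp :: "exp \<Rightarrow> exp" where
  "neg_exp e \<equiv> Equal e (Const 0)"

text \<open>Truth values are the words 0 and 1. In \<open>disj_exp\<close> their sum can reach 2,
  hence the bound on W. There is no short circuit: both operands must evaluate without
  fault.\<close>

lemma eval_bool:
  assumes "2 < W"
  shows eval_Equal: "eval W e s = Some x \<Longrightarrow> eval W f s = Some y \<Longrightarrow>
      eval W (Equal e f) s = Some (of_bool (x = y))"
    and eval_Less: "eval W e s = Some x \<Longrightarrow> eval W f s = Some y \<Longrightarrow>
      eval W (Less e f) s = Some (of_bool (x < y))"
    and eval_neg: "eval W e s = Some (of_bool p) \<Longrightarrow>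
      eval W (neg_exp e) s = Some (of_bool (\<not> p))"
    and eval_conj: "eval W e s = Some (of_bool p) \<Longrightarrow> eval W f s = Some (of_bool q) \<Longrightarrow>
      eval W (conj_exp e f) s = Some (of_bool (p \<and> q))"
    and eval_disj: "eval W e s = Some (of_bool p) \<Longrightarrow> eval W f s = Some (of_bool q) \<Longrightarrow>
      eval W (disj_exp e f) s = Some (of_bool (p \<or> q))"
  using assms by (auto simp: binop_def word_def)

lemma eval_Reg: "regs s r = x \<Longrightarrow> x < W \<Longrightarrow> eval W (Reg r) s = Some x"
  by (simp add: word_def)

abbreviation entry_exp :: "exp \<Rightarrow> exp \<Rightarrow> exp" where
  "entry_exp e f \<equiv> Load (Plus (Times e (Reg 0)) f)"

abbreviation mark_addr :: "exp \<Rightarrow> exp" where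
  "mark_addr e \<equiv> Plus (Times (Reg 0) (Reg 0)) e"

abbreviation slot_addr :: "exp \<Rightarrow> exp" where
  "slot_addr e \<equiv> Plus (Plus (Times (Reg 0) (Reg 0)) (Reg 0)) e"

abbreviation incr :: "nat \<Rightarrow> com" where
  "incr r \<equiv> Assign r (Plus (Reg r) (Const 1))"

text \<open>Register 5 is a loop counter \<open>y\<close>, registers 6 and 7 hold the head and the length of the
  queue, whose slots follow the characteristic vector in memory, register 8 holds the vertex
  \<open>x\<close> taken from the queue, and registers 9 and 10 record whether a vertex of the part \<open>C\<^sub>1\<close>,
  respectively \<open>D\<^sub>1\<close>, has been met.\<close>

abbreviation "entry_x_a2 \<equiv> entry_exp (Reg 8) (Reg 3)"
abbreviation "entry_x_b2 \<equiv> entry_exp (Reg 8) (Reg 4)"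
abbreviation "entry_a1_y \<equiv> entry_exp (Reg 1) (Reg 5)"
abbreviation "entry_b1_y \<equiv> entry_exp (Reg 2) (Reg 5)"
abbreviation "entry_x_y \<equiv> entry_exp (Reg 8) (Reg 5)"

definition joined_exp :: exp where
  "joined_exp = disj_exp
     (conj_exp (Equal entry_x_a2 (Const 2)) (Equal entry_a1_y (Const 2)))
     (conj_exp (Equal entry_x_b2 (Const 2)) (Equal entry_b1_y (Const 2)))"

text \<open>The language has no conditional expressions, so the last conjunct of \<open>fits\<close>
  is split into the cases joined with entry 2 and not joined with entry 0.\<close>

definition fits_exp :: exp where
  "fits_exp =
     conj_exp (neg_exp (Equal entry_x_a2 (Const 1)))
    (conj_exp (neg_exp (Equal entry_x_b2 (Const 1)))
    (conj_exp (neg_exp (Equal entry_a1_y (Const 1)))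
    (conj_exp (neg_exp (Equal entry_b1_y (Const 1)))
    (conj_exp (neg_exp (conj_exp (Equal entry_x_a2 entry_x_b2)
        (conj_exp (Equal entry_a1_y entry_b1_y) (neg_exp (Equal entry_x_a2 entry_a1_y)))))
      (disj_exp (conj_exp joined_exp (Equal entry_x_y (Const 2)))
        (conj_exp (neg_exp joined_exp) (Equal entry_x_y (Const 0))))))))"

definition enqueue :: com where
  "enqueue = Seq (Store (slot_addr (Reg 7)) (Reg 5)) (incr 7)"

definition fill :: com where
  "fill = While (Less (Reg 5) (Reg 0))
     (Seq (If (Load (mark_addr (Reg 5))) enqueue Skip) (incr 5))"

text \<open>Vertices are marked when they enter the queue, so each enters at most once and n slots
  suffice.\<close>

definition expand :: com where
  "expand = While (Less (Reg 5) (Reg 0))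
     (Seq (If (disj_exp (Load (mark_addr (Reg 5))) fits_exp) Skip
            (Seq (Store (mark_addr (Reg 5)) (Const 1)) enqueue))
       (incr 5))"

definition dequeue :: com where
  "dequeue =
     Seq (Assign 8 (Load (slot_addr (Reg 6))))
    (Seq (incr 6)
    (Seq (Assign 9 (disj_exp (Reg 9)
           (conj_exp (Equal entry_x_a2 (Const 0)) (Equal entry_x_b2 (Const 0)))))
    (Seq (Assign 10 (disj_exp (Reg 10)
           (conj_exp (Equal entry_x_a2 (Const 2)) (Equal entry_x_b2 (Const 2)))))
    (Assign 5 (Const 0)))))"

text \<open>The queue never shrinks and has no repetitions, so register 7 ends as the size of the
  closure; the comparison asks for at least four vertices outside it.\<close>

definition verdict :: exp where
  "verdict =
     conj_exp (neg_exp (Load (mark_addr (Reg 3))))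
    (conj_exp (neg_exp (Load (mark_addr (Reg 4))))
    (conj_exp (Less (Plus (Reg 7) (Const 3)) (Reg 0))
      (neg_exp (conj_exp (Reg 9) (Reg 10)))))"

text \<open>The cells that hold R0 are extended in place to the output set. Register 0 is
  overwritten last because all address computations use n.\<close>

definition closure_program :: com where
  "closure_program =
     Seq fill (Seq (While (Less (Reg 6) (Reg 7)) (Seq dequeue expand)) (Assign 0 verdict))"

section \<open>Evaluation of expressions in states that represent the queue and the marks\<close>

lemma Collect_less_Suc:
  "{y. y < Suc k \<and> P y} = (if P k then insert k {y. y < k \<and> P y} else {y. y < k \<and> P y})"
  by (auto simp: less_Suc_eq)

text \<open>Vertices are replaced by their numbers and the trigraph by a matrix. The bound on W
  accommodates the matrix, the n marks and the n queue slots.\<close>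

locale closure_input =
  fixes n W :: nat and M :: "nat \<Rightarrow> nat \<Rightarrow> nat" and a1 b1 a2 b2 :: nat
  assumes n: "3 \<le> n" and W: "n * n + 2 * n < W"
    and Z: "a1 < n" "b1 < n" "a2 < n" "b2 < n"
    and M: "i < n \<Longrightarrow> j < n \<Longrightarrow> M i j \<le> 2"
begin

text \<open>\<open>xs\<close> lists everything ever put into the queue, including vertices already
  taken out. The marked set K is separate, since it differs from \<open>set xs\<close> during
  \<open>fill\<close> and between marking and enqueuing. The scratch registers are left
  free.\<close>

definition represents :: "nat list \<Rightarrow> nat set \<Rightarrow> state \<Rightarrow> bool" where
  "represents xs K s \<longleftrightarrow>
     regs s 0 = n \<and> regs s 1 = a1 \<and> regs s 2 = b1 \<and> regs s 3 = a2 \<and> regs s 4 = b2 \<and>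
     regs s 7 = length xs \<and> distinct xs \<and> set xs \<subseteq> {..<n} \<and>
     (\<forall>i<n. \<forall>j<n. mem s (i * n + j) = M i j) \<and>
     (\<forall>i<n. mem s (n * n + i) = of_bool (i \<in> K)) \<and>
     (\<forall>i<length xs. mem s (n * n + n + i) = xs ! i)"

lemma index_less: "i < n \<Longrightarrow> j < n \<Longrightarrow> i * n + j < n * n"
proof -
  assume "i < n" "j < n"
  then have "i * n + j < Suc i * n" by simp
  also have "\<dots> \<le> n * n" using \<open>i < n\<close> by (intro mult_right_mono) auto
  finally show ?thesis .
qed

lemma two_less_W: "2 < W"
  using n W by simp

lemma represents_length: "represents xs K s \<Longrightarrow> length xs \<le> n"
  unfolding represents_def
  by (metis card_lessThan card_mono distinct_card finite_lessThan)

lemma represents_set_reg: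
  assumes "r \<notin> {0, 1, 2, 3, 4, 7}"
  shows "represents xs K (s\<lparr>regs := (regs s)(r := v)\<rparr>) = represents xs K s"
  using assms by (auto simp: represents_def)

lemma eval_entry:
  assumes "represents xs K s" "regs s p = i" "regs s q = j" "i < n" "j < n"
  shows "eval W (entry_exp (Reg p) (Reg q)) s = Some (M i j)"
proof -
  have "i * n + j < n * n" "M i j \<le> 2" using assms index_less M by auto
  moreover from this have "i * n < W" "i * n + j < W" "i < W" "j < W" "n < W" "M i j < W"
    using W n assms by linarith+
  ultimately show ?thesis
    using assms by (auto simp: represents_def binop_def word_def)
qed

lemma square_less_W: "n * n < W" "n < W"
  using W n by linarith+

lemma eval_mark_addr:
  assumes "represents xs K s" "regs s p = i" "i < n"
  shows "eval W (mark_addr (Reg p)) s = Some (n * n + i)"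
proof -
  have "n * n + i < W" "i < W" using assms W by linarith+
  then show ?thesis
    using assms square_less_W by (auto simp: represents_def binop_def word_def)
qed

lemma eval_mark:
  assumes "represents xs K s" "regs s p = i" "i < n"
  shows "eval W (Load (mark_addr (Reg p))) s = Some (of_bool (i \<in> K))"
proof -
  have "mem s (n * n + i) = of_bool (i \<in> K)" using assms by (simp add: represents_def)
  then show ?thesis
    unfolding eval.simps(3) eval_mark_addr[OF assms] using two_less_W by (auto simp: word_def)
qed

lemma eval_slot_addr:
  assumes "represents xs K s" "regs s p = i" "i < n"
  shows "eval W (slot_addr (Reg p)) s = Some (n * n + n + i)"
proof -
  have "n * n + n + i < W" "n * n + n < W" "i < W" using assms W by linarith+
  then show ?thesis
    using assms square_less_W by (auto simp: represents_def binop_def word_def)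
qed

lemma eval_slot:
  assumes "represents xs K s" "regs s p = i" "i < length xs"
  shows "eval W (Load (slot_addr (Reg p))) s = Some (xs ! i)"
proof -
  have i: "i < n" using represents_length[OF assms(1)] assms(3) by simp
  have "mem s (n * n + n + i) = xs ! i" "set xs \<subseteq> {..<n}"
    using assms by (auto simp: represents_def)
  moreover from this have "xs ! i < n" using nth_mem[OF assms(3)] by blast
  ultimately show ?thesis
    unfolding eval.simps(3) eval_slot_addr[OF assms(1,2) i] using square_less_W
    by (auto simp: word_def)
qed

lemma eval_fits:
  assumes "represents xs K s" "regs s 8 = x" "regs s 5 = y" "x < n" "y < n"
  shows "eval W fits_exp s = Some (of_bool (fits M a1 b1 a2 b2 x y))"
proof -
  have r: "regs s 1 = a1" "regs s 2 = b1" "regs s 3 = a2" "regs s 4 = b2"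
    using assms(1) by (simp_all add: represents_def)
  note e = eval_entry[OF assms(1,2) r(3) assms(4) Z(3)] eval_entry[OF assms(1,2) r(4) assms(4) Z(4)]
    eval_entry[OF assms(1) r(1) assms(3) Z(1) assms(5)]
    eval_entry[OF assms(1) r(2) assms(3) Z(2) assms(5)]
    eval_entry[OF assms(1,2,3,4,5)]
  note b = eval_bool[OF two_less_W]
  have c: "eval W (Const c) s = Some c" if "c \<le> 2" for c
    using that two_less_W by (simp add: word_def)
  let ?J = "M x a2 = 2 \<and> M a1 y = 2 \<or> M x b2 = 2 \<and> M b1 y = 2"
  have J: "eval W joined_exp s = Some (of_bool ?J)"
    unfolding joined_exp_def by (rule b(5) b(4) b(1) e c order_refl)+
  have "eval W fits_exp s = Some (of_bool (\<not> M x a2 = 1 \<and> \<not> M x b2 = 1 \<and> \<not> M a1 y = 1 \<and>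
      \<not> M b1 y = 1 \<and> \<not> (M x a2 = M x b2 \<and> M a1 y = M b1 y \<and> \<not> M x a2 = M a1 y) \<and>
      (?J \<and> M x y = 2 \<or> \<not> ?J \<and> M x y = 0)))"
    unfolding fits_exp_def
    by (rule b(5) b(4) b(3) J b(1) e c order_refl one_le_numeral zero_le)+
  moreover have "(?J \<and> M x y = 2 \<or> \<not> ?J \<and> M x y = 0) \<longleftrightarrow> M x y = (if ?J then 2 else 0)" by auto
  ultimately show ?thesis unfolding fits_def by simp
qed

section \<open>Running times of the commands and inner loops\<close>

lemma runs_incr:
  assumes "regs s r = i" "i < n" "Q (s\<lparr>regs := (regs s)(r := Suc i)\<rparr>)" "4 \<le> B"
  shows "runs W (incr r) B Q s"
  by (rule runs_Assign[where x = "Suc i"])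
    (use assms square_less_W n in \<open>auto simp: binop_def word_def\<close>)

lemma runs_enqueue:
  assumes s: "represents xs K s" and y: "regs s 5 = y" "y < n" "y \<notin> set xs"
  shows "runs W enqueue 20 (\<lambda>s'. represents (xs @ [y]) K s' \<and> (\<forall>r. r \<noteq> 7 \<longrightarrow> regs s' r = regs s r)) s"
proof -
  \<comment> \<open>The queue together with the new vertex is still a list of distinct numbers below
    n, so a free slot remains.\<close>
  have "set (y # xs) \<subseteq> {..<n}" "distinct (y # xs)" using s y by (auto simp: represents_def)
  then have "length (y # xs) \<le> n"
    by (metis card_lessThan card_mono distinct_card finite_lessThan)
  then have len: "length xs < n" by simp
  have r: "regs s 7 = length xs" using s by (simp add: represents_def)
  \<comment> \<open>Matrix cells lie below \<open>n * n\<close>, so writing the slot leaves them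
    intact.\<close>
  have mat: "i * n + j \<noteq> n * n + n + length xs" if "i < n" "j < n" for i j
    using index_less[OF that] by simp
  have y': "eval W (Reg 5) s = Some y" using y square_less_W by (simp add: word_def)
  have "represents (xs @ [y]) K (s\<lparr>mem := (mem s)(n * n + n + length xs := y),
      regs := (regs s)(7 := Suc (length xs))\<rparr>)"
    using s y mat by (auto simp: represents_def nth_append less_Suc_eq)
  then show ?thesis
    unfolding enqueue_def
    by (intro runs_Seq[where B = 10 and B' = 4] runs_Store[OF eval_slot_addr[OF s r len] y']
        runs_incr[OF _ len]) (auto simp: r)
qed

lemma runs_mark:
  assumes s: "represents xs K s" and y: "regs s 5 = y" "y < n"
  shows "runs W (Store (mark_addr (Reg 5)) (Const 1)) 10
    (\<lambda>s'. represents xs (insert y K) s' \<and> regs s' = regs s) s"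
proof -
  have one: "eval W (Const 1) s = Some 1" using two_less_W by (simp add: word_def)
  have mat: "i * n + j \<noteq> n * n + y" if "i < n" "j < n" for i j
    using index_less[OF that] by simp
  have "represents xs (insert y K) (s\<lparr>mem := (mem s)(n * n + y := 1)\<rparr>)"
    using s y mat by (auto simp: represents_def)
  then show ?thesis
    by (intro runs_Store[OF eval_mark_addr[OF s y] one]) auto
qed

lemma eval_counter:
  assumes "represents xs K s" "regs s 5 \<le> n"
  shows "eval W (Less (Reg 5) (Reg 0)) s = Some (of_bool (regs s 5 < n))"
proof -
  have "regs s 0 = n" using assms(1) by (simp add: represents_def)
  then show ?thesis
    by (intro eval_bool(2)[OF two_less_W] eval_Reg)
      (use assms(2) square_less_W in auto)
qed

text \<open>All of K is marked from the start. After y rounds the queue holds the marked vertices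
  below y, and at y = n this is all of K.\<close>

lemma runs_fill:
  assumes s: "represents [] K s" and r: "regs s 5 = 0" and K: "K \<subseteq> {..<n}"
  shows "runs W fill (n * 100 + 10)
    (\<lambda>s'. \<exists>xs. represents xs (set xs) s' \<and> set xs = K \<and>
       (\<forall>r\<in>{6, 9, 10}. regs s' r = regs s r)) s"
  unfolding fill_def
proof (rule runs_While[where B = 40 and f = "\<lambda>s. n - regs s 5" and
      I = "\<lambda>s'. \<exists>xs. represents xs K s' \<and> regs s' 5 \<le> n \<and> set xs = K \<inter> {..<regs s' 5} \<and>
             (\<forall>r\<in>{6, 9, 10}. regs s' r = regs s r)"], goal_cases)
  case 1
  show ?case using s r by (intro exI[of _ "[]"]) auto
next
  case (2 s1)
  then obtain xs where I: "represents xs K s1" "regs s1 5 \<le> n" "set xs = K \<inter> {..<regs s1 5}"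
    "\<forall>r\<in>{6, 9, 10}. regs s1 r = regs s r" by blast
  let ?y = "regs s1 5"
  let ?Q = "\<lambda>s'. (\<exists>xs. represents xs K s' \<and> regs s' 5 \<le> n \<and> set xs = K \<inter> {..<regs s' 5} \<and>
             (\<forall>r\<in>{6, 9, 10}. regs s' r = regs s r)) \<and> n - regs s' 5 < n - regs s1 5"
  have last: "runs W (incr 5) 4 ?Q s2" if y: "?y < n" and s2: "represents ys K s2"
    "set ys = K \<inter> {..<Suc ?y}" "\<forall>r. r \<noteq> 7 \<longrightarrow> regs s2 r = regs s1 r" for s2 ys
  proof (rule runs_incr[OF _ y])
    show "regs s2 5 = ?y" using s2 by simp
    show "?Q (s2\<lparr>regs := (regs s2)(5 := Suc ?y)\<rparr>)"
      using s2 y I(4) by (auto intro!: exI[of _ ys] simp: represents_set_reg)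
  qed simp
  have body: "runs W (Seq (If (Load (mark_addr (Reg 5))) enqueue Skip) (incr 5)) 40 ?Q s1"
    if y: "?y < n"
  proof (intro runs_Seq[where B = 30 and B' = 4] runs_If[OF eval_mark[OF I(1) refl y], where B = 20])
    assume "of_bool (?y \<in> K) \<noteq> (0::nat)"
    then have yK: "?y \<in> K" by simp
    have y': "?y \<notin> set xs" using I(3) by simp
    have new: "set (xs @ [?y]) = K \<inter> {..<Suc ?y}"
      using yK unfolding set_append I(3) lessThan_Suc by simp
    show "runs W enqueue 20 (runs W (incr 5) 4 ?Q) s1"
    proof (rule runs_mono[OF runs_enqueue[OF I(1) refl y y']])
      fix s2 assume "represents (xs @ [?y]) K s2 \<and> (\<forall>r. r \<noteq> 7 \<longrightarrow> regs s2 r = regs s1 r)"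
      then show "runs W (incr 5) 4 ?Q s2" using last[OF y _ new, of s2] by blast
    qed simp
  next
    assume "of_bool (?y \<in> K) = (0::nat)"
    then have "set xs = K \<inter> {..<Suc ?y}" unfolding I(3) lessThan_Suc by simp
    from last[OF y I(1) this] show "runs W Skip 20 (runs W (incr 5) 4 ?Q) s1"
      by (intro runs_Skip) simp_all
  qed simp_all
  have "set xs = K" if "\<not> ?y < n"
  proof -
    have "?y = n" using that I(2) by simp
    with I(3) K show ?thesis by (simp add: Int_absorb2)
  qed
  then show ?case
    using I by (intro exI[of _ "of_bool (?y < n)"] conjI impI eval_counter[OF I(1,2)] body exI[of _ xs]) auto
next
  case 3
  show ?case using r by simp
qed

text \<open>The queue is only extended at its end, so the vertices already processed keep their
  positions. The invariant also fixes register 8, because x must stay the same throughout the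
  scan.\<close>

lemma runs_expand:
  assumes s: "represents xs (set xs) s" and r: "regs s 5 = 0" "regs s 8 = x" and x: "x < n"
  shows "runs W expand (n * 400 + 10)
    (\<lambda>s'. \<exists>ys. represents (xs @ ys) (set (xs @ ys)) s' \<and>
       set (xs @ ys) = set xs \<union> {y. y < n \<and> \<not> fits M a1 b1 a2 b2 x y} \<and>
       (\<forall>r\<in>{6, 9, 10}. regs s' r = regs s r)) s"
  unfolding expand_def
proof (rule runs_While[where B = 390 and f = "\<lambda>s. n - regs s 5" and
      I = "\<lambda>s'. \<exists>ys. represents (xs @ ys) (set (xs @ ys)) s' \<and> regs s' 5 \<le> n \<and>
             set (xs @ ys) = set xs \<union> {y. y < regs s' 5 \<and> \<not> fits M a1 b1 a2 b2 x y} \<and>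
             (\<forall>r\<in>{6, 8, 9, 10}. regs s' r = regs s r)"], goal_cases)
  case 1
  show ?case using s r by (intro exI[of _ "[]"]) auto
next
  case (2 s1)
  then obtain ys where I: "represents (xs @ ys) (set (xs @ ys)) s1" "regs s1 5 \<le> n"
    "set (xs @ ys) = set xs \<union> {y. y < regs s1 5 \<and> \<not> fits M a1 b1 a2 b2 x y}"
    "\<forall>r\<in>{6, 8, 9, 10}. regs s1 r = regs s r" by blast
  let ?y = "regs s1 5" and ?f = "fits M a1 b1 a2 b2 x" and ?zs = "xs @ ys"
  let ?Q = "\<lambda>s'. (\<exists>ys. represents (xs @ ys) (set (xs @ ys)) s' \<and> regs s' 5 \<le> n \<and>
             set (xs @ ys) = set xs \<union> {y. y < regs s' 5 \<and> \<not> ?f y} \<and>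
             (\<forall>r\<in>{6, 8, 9, 10}. regs s' r = regs s r)) \<and> n - regs s' 5 < n - regs s1 5"
  have last: "runs W (incr 5) 4 ?Q s2" if y: "?y < n" and s2: "represents (xs @ zs) (set (xs @ zs)) s2"
    "set (xs @ zs) = set xs \<union> {y. y < Suc ?y \<and> \<not> ?f y}"
    "\<forall>r. r \<noteq> 7 \<longrightarrow> regs s2 r = regs s1 r" for s2 zs
  proof (rule runs_incr[OF _ y])
    show "regs s2 5 = ?y" using s2 by simp
    show "?Q (s2\<lparr>regs := (regs s2)(5 := Suc ?y)\<rparr>)"
      using s2 y I(4) by (intro conjI exI[of _ zs]) (auto simp: represents_set_reg)
  qed simp
  have r8: "regs s1 8 = x" using I(4) r by simp
  have body: "runs W (Seq (If (disj_exp (Load (mark_addr (Reg 5))) fits_exp) Skip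
      (Seq (Store (mark_addr (Reg 5)) (Const 1)) enqueue)) (incr 5)) 390 ?Q s1"
    if y: "?y < n"
  proof (rule runs_Seq[where B = 380 and B' = 4], rule runs_If[where B = 40, OF
      eval_bool(5)[OF two_less_W eval_mark[OF I(1) refl y] eval_fits[OF I(1) r8 refl x y]]])
    assume "of_bool (?y \<in> set ?zs \<or> ?f ?y) \<noteq> (0::nat)"
    then have "?y \<in> set ?zs \<or> ?f ?y" by simp
    \<comment> \<open>If y does not fit x it is in the queue already, so admitting y to the
      comprehension adds nothing new.\<close>
    then have "set ?zs = set xs \<union> {y. y < Suc ?y \<and> \<not> ?f y}"
      unfolding I(3) Collect_less_Suc by auto
    from last[OF y I(1) this] show "runs W Skip 40 (runs W (incr 5) 4 ?Q) s1"
      by (intro runs_Skip) simp_all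
  next
    assume "of_bool (?y \<in> set ?zs \<or> ?f ?y) = (0::nat)"
    then have y': "?y \<notin> set ?zs" "\<not> ?f ?y" by simp_all
    show "runs W (Seq (Store (mark_addr (Reg 5)) (Const 1)) enqueue) 40 (runs W (incr 5) 4 ?Q) s1"
    proof (rule runs_Seq[where B = 10 and B' = 20])
      show "runs W (Store (mark_addr (Reg 5)) (Const 1)) 10
        (runs W enqueue 20 (runs W (incr 5) 4 ?Q)) s1"
      proof (rule runs_mono[OF runs_mark[OF I(1) refl y]])
        fix s2 assume s2: "represents ?zs (insert ?y (set ?zs)) s2 \<and> regs s2 = regs s1"
        then have y2: "regs s2 5 = ?y" by simp
        show "runs W enqueue 20 (runs W (incr 5) 4 ?Q) s2"
        proof (rule runs_mono[OF runs_enqueue[OF conjunct1[OF s2] y2 y y'(1)]])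
          fix s3 assume "represents (?zs @ [?y]) (insert ?y (set ?zs)) s3 \<and>
            (\<forall>r. r \<noteq> 7 \<longrightarrow> regs s3 r = regs s2 r)"
          moreover have "set (xs @ (ys @ [?y])) = set xs \<union> {y. y < Suc ?y \<and> \<not> ?f y}"
            using I(3) y'(2) unfolding Collect_less_Suc by simp
          ultimately show "runs W (incr 5) 4 ?Q s3"
            using s2 by (intro last[OF y, of "ys @ [?y]"]) auto
        qed simp
      qed simp
    qed simp
  qed (simp_all add: fits_exp_def joined_exp_def)
  have "set ?zs = set xs \<union> {y. y < n \<and> \<not> ?f y}" if "\<not> ?y < n"
  proof -
    have "?y = n" using that I(2) by simp
    with I(3) show ?thesis by simp
  qed
  then show ?case
    using I by (intro exI[of _ "of_bool (?y < n)"] conjI impI eval_counter[OF I(1,2)] body exI[of _ ys]) auto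
next
  case 3
  show ?case using r by simp
qed

lemma runs_dequeue:
  assumes s: "represents xs K s" and h: "regs s 6 = h" "h < length xs"
    and c: "regs s 9 = of_bool p" and d: "regs s 10 = of_bool q"
  shows "runs W dequeue 100 (\<lambda>s'. represents xs K s' \<and>
      regs s' 5 = 0 \<and> regs s' 6 = Suc h \<and> regs s' 8 = xs ! h \<and>
      regs s' 9 = of_bool (p \<or> M (xs ! h) a2 = 0 \<and> M (xs ! h) b2 = 0) \<and>
      regs s' 10 = of_bool (q \<or> M (xs ! h) a2 = 2 \<and> M (xs ! h) b2 = 2)) s"
proof -
  let ?x = "xs ! h"
  let ?p = "p \<or> M ?x a2 = 0 \<and> M ?x b2 = 0" and ?q = "q \<or> M ?x a2 = 2 \<and> M ?x b2 = 2"
  have "set xs \<subseteq> {..<n}" using s by (simp add: represents_def)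
  then have x: "?x < n" using nth_mem[OF h(2)] by blast
  have hn: "h < n" using represents_length[OF s] h(2) by simp
  define s1 where "s1 = s\<lparr>regs := (regs s)(8 := ?x)\<rparr>"
  define s2 where "s2 = s1\<lparr>regs := (regs s1)(6 := Suc h)\<rparr>"
  define s3 where "s3 = s2\<lparr>regs := (regs s2)(9 := of_bool ?p)\<rparr>"
  define s4 where "s4 = s3\<lparr>regs := (regs s3)(10 := of_bool ?q)\<rparr>"
  define s5 where "s5 = s4\<lparr>regs := (regs s4)(5 := 0)\<rparr>"
  have rep: "represents xs K s1" "represents xs K s2" "represents xs K s3" "represents xs K s4"
    "represents xs K s5"
  proof -
    show r1: "represents xs K s1" using s unfolding s1_def by (subst represents_set_reg) simp_all
    then show r2: "represents xs K s2" unfolding s2_def by (subst represents_set_reg) simp_all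
    then show r3: "represents xs K s3" unfolding s3_def by (subst represents_set_reg) simp_all
    then show r4: "represents xs K s4" unfolding s4_def by (subst represents_set_reg) simp_all
    then show "represents xs K s5" unfolding s5_def by (subst represents_set_reg) simp_all
  qed
  have bool: "of_bool b < W" for b using two_less_W by (cases b) simp_all
  have c0: "eval W (Const c) t = Some c" if "c \<le> 2" for c t
    using that two_less_W by (simp add: word_def)
  note b = eval_bool[OF two_less_W]
  have entries: "eval W entry_x_a2 t = Some (M ?x a2)" "eval W entry_x_b2 t = Some (M ?x b2)"
    if "represents xs K t" "regs t 8 = ?x" for t
  proof -
    have "regs t 3 = a2" "regs t 4 = b2" using that(1) by (simp_all add: represents_def)
    then show "eval W entry_x_a2 t = Some (M ?x a2)" "eval W entry_x_b2 t = Some (M ?x b2)"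
      using eval_entry[OF that _ x] Z by blast+
  qed
  have r2: "regs s2 8 = ?x" "regs s2 9 = of_bool p" and r3: "regs s3 8 = ?x" "regs s3 10 = of_bool q"
    using c d by (simp_all add: s1_def s2_def s3_def)
  have e3: "eval W (disj_exp (Reg 9)
      (conj_exp (Equal entry_x_a2 (Const 0)) (Equal entry_x_b2 (Const 0)))) s2 = Some (of_bool ?p)"
    by (rule b(5) b(4) b(1) eval_Reg[OF r2(2) bool] entries[OF rep(2) r2(1)] c0 zero_le)+
  have e4: "eval W (disj_exp (Reg 10)
      (conj_exp (Equal entry_x_a2 (Const 2)) (Equal entry_x_b2 (Const 2)))) s3 = Some (of_bool ?q)"
    by (rule b(5) b(4) b(1) eval_Reg[OF r3(2) bool] entries[OF rep(3) r3(1)] c0 order_refl)+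
  let ?Q = "\<lambda>s'. represents xs K s' \<and> regs s' 5 = 0 \<and> regs s' 6 = Suc h \<and> regs s' 8 = ?x \<and>
      regs s' 9 = of_bool ?p \<and> regs s' 10 = of_bool ?q"
  have Q: "?Q s5" using rep(5) by (simp add: s1_def s2_def s3_def s4_def s5_def)
  \<comment> \<open>The postcondition is pulled back through the assignments, from the last to the
    first.\<close>
  have "runs W (Assign 5 (Const 0)) 2 ?Q s4"
    by (rule runs_Assign[OF c0[OF zero_le]]) (use Q in \<open>simp_all add: s5_def\<close>)
  then have "runs W (Assign 10 (disj_exp (Reg 10)
      (conj_exp (Equal entry_x_a2 (Const 2)) (Equal entry_x_b2 (Const 2))))) 30
      (runs W (Assign 5 (Const 0)) 2 ?Q) s3"
    by (intro runs_Assign[OF e4]) (simp_all add: s4_def)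
  then have "runs W (Assign 9 (disj_exp (Reg 9)
      (conj_exp (Equal entry_x_a2 (Const 0)) (Equal entry_x_b2 (Const 0))))) 30
      (runs W (Seq (Assign 10 (disj_exp (Reg 10)
      (conj_exp (Equal entry_x_a2 (Const 2)) (Equal entry_x_b2 (Const 2)))))
      (Assign 5 (Const 0))) 32 ?Q) s2"
    by (intro runs_Assign[OF e3] runs_Seq[where B = 30 and B' = 2]) (simp_all add: s3_def)
  note tail = runs_Seq[OF this, of 62, simplified]
  have "regs s1 6 = h" using h by (simp add: s1_def)
  from runs_incr[OF this hn _ order_refl, of "runs W _ 62 ?Q"] tail
  have "runs W (incr 6) 4 (runs W (Seq (Assign 9 (disj_exp (Reg 9)
      (conj_exp (Equal entry_x_a2 (Const 0)) (Equal entry_x_b2 (Const 0)))))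
      (Seq (Assign 10 (disj_exp (Reg 10)
      (conj_exp (Equal entry_x_a2 (Const 2)) (Equal entry_x_b2 (Const 2)))))
      (Assign 5 (Const 0)))) 62 ?Q) s1"
    by (simp add: s2_def)
  then show ?thesis
    unfolding dequeue_def
    by (intro runs_Seq[where B = 10 and B' = 66] runs_Assign[OF eval_slot[OF s h]]
        runs_Seq[where B = 4 and B' = 62]) (simp_all add: s1_def)
qed

section \<open>The queue search for the least closed set\<close>

definition fits_closed :: "nat set \<Rightarrow> bool" where
  "fits_closed S \<longleftrightarrow> (\<forall>x\<in>S. \<forall>y<n. \<not> fits M a1 b1 a2 b2 x y \<longrightarrow> y \<in> S)"

text \<open>\<open>D\<close> is the set of vertices already taken from the queue.\<close>

definition search_inv :: "nat set \<Rightarrow> nat list \<Rightarrow> nat set \<Rightarrow> state \<Rightarrow> bool" where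
  "search_inv R xs D s \<longleftrightarrow> represents xs (set xs) s \<and> R \<subseteq> set xs \<and>
     (\<forall>S. R \<subseteq> S \<and> fits_closed S \<longrightarrow> set xs \<subseteq> S) \<and>
     (\<forall>x\<in>D. \<forall>y<n. \<not> fits M a1 b1 a2 b2 x y \<longrightarrow> y \<in> set xs) \<and>
     regs s 9 = of_bool (\<exists>x\<in>D. M x a2 = 0 \<and> M x b2 = 0) \<and>
     regs s 10 = of_bool (\<exists>x\<in>D. M x a2 = 2 \<and> M x b2 = 2)"

text \<open>One round moves the vertex at position h into the processed prefix:
  \<open>dequeue\<close> updates the flags for it and \<open>expand\<close> enqueues every vertex
  that it forces.\<close>

lemma runs_step:
  assumes I: "search_inv R xs (set (take h xs)) s" and h: "regs s 6 = h" "h < length xs"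
  shows "runs W (Seq dequeue expand) (n * 400 + 110)
    (\<lambda>s'. \<exists>zs. search_inv R zs (set (take (Suc h) zs)) s' \<and> Suc h \<le> length zs \<and> regs s' 6 = Suc h) s"
proof (rule runs_Seq[where B = 100 and B' = "n * 400 + 10"])
  let ?x = "xs ! h" and ?Q = "\<lambda>s'. \<exists>zs. search_inv R zs (set (take (Suc h) zs)) s' \<and>
      Suc h \<le> length zs \<and> regs s' 6 = Suc h"
  have rep: "represents xs (set xs) s"
    and sub: "R \<subseteq> set xs" "\<And>S. R \<subseteq> S \<Longrightarrow> fits_closed S \<Longrightarrow> set xs \<subseteq> S"
    and done_: "\<And>x y. x \<in> set (take h xs) \<Longrightarrow> y < n \<Longrightarrow> \<not> fits M a1 b1 a2 b2 x y \<Longrightarrow> y \<in> set xs"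
    and c: "regs s 9 = of_bool (\<exists>x\<in>set (take h xs). M x a2 = 0 \<and> M x b2 = 0)"
    and d: "regs s 10 = of_bool (\<exists>x\<in>set (take h xs). M x a2 = 2 \<and> M x b2 = 2)"
    using I unfolding search_inv_def by blast+
  have xin: "?x \<in> set xs" using h(2) by simp
  have "set xs \<subseteq> {..<n}" using rep by (simp add: represents_def)
  with xin have x: "?x < n" by blast
  show "runs W dequeue 100 (runs W expand (n * 400 + 10) ?Q) s"
  proof (rule runs_mono[OF runs_dequeue[OF rep h c d]], goal_cases)
    case (2 s1)
    then have s1: "represents xs (set xs) s1" "regs s1 5 = 0" "regs s1 8 = ?x" by blast+
    show ?case
    proof (rule runs_mono[OF runs_expand[OF s1 x]], goal_cases)
      case (2 s2)
      then obtain ys where ys: "represents (xs @ ys) (set (xs @ ys)) s2"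
        "set (xs @ ys) = set xs \<union> {y. y < n \<and> \<not> fits M a1 b1 a2 b2 ?x y}"
        "\<forall>r\<in>{6, 9, 10}. regs s2 r = regs s1 r" by blast
      let ?zs = "xs @ ys"
      have tk: "set (take (Suc h) ?zs) = insert ?x (set (take h xs))"
        using h(2) by (simp add: take_Suc_conv_app_nth)
      have 0: "R \<subseteq> set ?zs" using sub(1) by auto
      \<comment> \<open>The vertex taken from the queue already lies in S, so closedness puts every
        newly added vertex into S.\<close>
      have 1: "set ?zs \<subseteq> S" if "R \<subseteq> S" "fits_closed S" for S
      proof -
        have "set xs \<subseteq> S" using sub(2) that .
        then show ?thesis using that(2) xin unfolding ys(2) fits_closed_def by blast
      qed
      have 2: "y \<in> set ?zs" if "x \<in> insert ?x (set (take h xs))" "y < n"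
        "\<not> fits M a1 b1 a2 b2 x y" for x y
        using that done_[of x y] unfolding ys(2) by blast
      have 3: "regs s2 9 = of_bool (\<exists>x\<in>insert ?x (set (take h xs)). M x a2 = 0 \<and> M x b2 = 0)"
        "regs s2 10 = of_bool (\<exists>x\<in>insert ?x (set (take h xs)). M x a2 = 2 \<and> M x b2 = 2)"
        "regs s2 6 = Suc h"
        using ys(3) \<open>represents xs (set xs) s1 \<and> _\<close> by (simp_all add: disj_commute)
      have "search_inv R ?zs (set (take (Suc h) ?zs)) s2"
        unfolding search_inv_def tk using ys(1) 0 1 2 3 by blast
      then show ?case using 3 h(2) by (intro exI[of _ ?zs]) simp
    qed simp
  qed simp
qed simp

text \<open>The head of the queue advances in each round and never passes n, giving at most n rounds
  of linear cost. When it reaches the end, the processed vertices are the whole queue.\<close>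

lemma runs_closure_program:
  assumes s: "represents [] R s" "regs s 5 = 0" "regs s 6 = 0" "regs s 9 = 0" "regs s 10 = 0"
    and R: "R \<subseteq> {..<n}"
  shows "runs W closure_program (1000 * n\<^sup>2) (\<lambda>s'. \<exists>K \<subseteq> {..<n}. R \<subseteq> K \<and> fits_closed K \<and>
     (\<forall>S. R \<subseteq> S \<and> fits_closed S \<longrightarrow> K \<subseteq> S) \<and>
     (\<forall>i<n. mem s' (n * n + i) = of_bool (i \<in> K)) \<and>
     regs s' 0 = of_bool (a2 \<notin> K \<and> b2 \<notin> K \<and> card K + 3 < n \<and> \<not> meets_C1_D1 M a2 b2 K)) s"
    (is "runs W _ _ ?Q s")
  unfolding closure_program_def
proof (rule runs_Seq[where B = "n * 100 + 10" and B' = "n * (n * 400 + 120) + 60"])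
  show "runs W fill (n * 100 + 10) (runs W (Seq (While (Less (Reg 6) (Reg 7)) (Seq dequeue expand))
      (Assign 0 verdict)) (n * (n * 400 + 120) + 60) ?Q) s"
  proof (rule runs_mono[OF runs_fill[OF s(1,2) R]], goal_cases)
    case (2 s1)
    then obtain xs where xs: "represents xs (set xs) s1" "set xs = R"
      "\<forall>r\<in>{6, 9, 10}. regs s1 r = regs s r" by blast
    let ?I = "\<lambda>s'. \<exists>xs h. search_inv R xs (set (take h xs)) s' \<and> h \<le> length xs \<and> regs s' 6 = h"
    let ?P = "\<lambda>s'. \<exists>xs. search_inv R xs (set xs) s'"
    have I1: "?I s1"
      using xs s by (intro exI[of _ xs] exI[of _ 0]) (simp add: search_inv_def)
    have search: "runs W (While (Less (Reg 6) (Reg 7)) (Seq dequeue expand)) (n * (n * 400 + 120) + 10) ?P s1"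
    proof (rule runs_While[where B = "n * 400 + 110" and f = "\<lambda>s. n - regs s 6" and I = ?I],
        goal_cases)
      case 1 show ?case by (rule I1)
    next
      case (2 s2)
      then obtain ys h where I: "search_inv R ys (set (take h ys)) s2" "h \<le> length ys"
        "regs s2 6 = h" by blast
      have rep: "represents ys (set ys) s2" using I(1) by (simp add: search_inv_def)
      have len: "length ys \<le> n" using represents_length[OF rep] .
      have r7: "regs s2 7 = length ys" using rep by (simp add: represents_def)
      have ev: "eval W (Less (Reg 6) (Reg 7)) s2 = Some (of_bool (h < length ys))"
        by (intro eval_bool(2)[OF two_less_W] eval_Reg I(3) r7) (use I(2) len square_less_W in auto)
      have step: "runs W (Seq dequeue expand) (n * 400 + 110)
          (\<lambda>s'. ?I s' \<and> n - regs s' 6 < n - regs s2 6) s2" if "h < length ys"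
      proof (rule runs_mono[OF runs_step[OF I(1,3) that]], goal_cases)
        case (2 s3)
        then obtain zs where zs: "search_inv R zs (set (take (Suc h) zs)) s3" "Suc h \<le> length zs"
          "regs s3 6 = Suc h" by blast
        then have "?I s3" by blast
        then show ?case using zs(3) I(3) that len by simp
      qed simp
      have "?P s2" if "\<not> h < length ys" using that I by (intro exI[of _ ys]) simp
      then show ?case
        by (intro exI[of _ "of_bool (h < length ys)"] conjI impI ev step) auto
    next
      case 3
      show ?case by (simp add: algebra_simps)
    qed
    show ?case
    proof (rule runs_Seq[where B = "n * (n * 400 + 120) + 10" and B' = 50],
        rule runs_mono[OF search], goal_cases)
      case (2 s2)
      then obtain zs where J: "search_inv R zs (set zs) s2" by blast
      then have rep: "represents zs (set zs) s2" by (simp add: search_inv_def)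
      let ?v = "a2 \<notin> set zs \<and> b2 \<notin> set zs \<and> card (set zs) + 3 < n \<and> \<not> meets_C1_D1 M a2 b2 (set zs)"
      have r: "regs s2 0 = n" "regs s2 3 = a2" "regs s2 4 = b2" "regs s2 7 = length zs"
        and dist: "distinct zs" "set zs \<subseteq> {..<n}"
        and marks: "\<forall>i<n. mem s2 (n * n + i) = of_bool (i \<in> set zs)"
        using rep unfolding represents_def by blast+
      have len: "length zs \<le> n" using represents_length[OF rep] .
      have "n * n \<ge> 3 * n" using n by (intro mult_right_mono) auto
      then have W': "length zs + 3 < W" using len n W by linarith
      have bool: "of_bool b < W" for b using two_less_W by (cases b) simp_all
      note b = eval_bool[OF two_less_W]
      have sum: "eval W (Plus (Reg 7) (Const 3)) s2 = Some (length zs + 3)"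
        using r(4) W' by (simp add: binop_def word_def)
      let ?c = "\<exists>x\<in>set zs. M x a2 = 0 \<and> M x b2 = 0" and ?d = "\<exists>x\<in>set zs. M x a2 = 2 \<and> M x b2 = 2"
      have cd: "regs s2 9 = of_bool ?c" "regs s2 10 = of_bool ?d"
        using J unfolding search_inv_def by blast+
      have "eval W verdict s2 = Some (of_bool (a2 \<notin> set zs \<and> b2 \<notin> set zs \<and> length zs + 3 < n \<and>
          \<not> (?c \<and> ?d)))"
        unfolding verdict_def
        by (rule b(4) b(3) b(2) sum eval_mark[OF rep r(2) Z(3)] eval_mark[OF rep r(3) Z(4)]
            eval_Reg[OF r(1) square_less_W(2)] eval_Reg[OF cd(1) bool] eval_Reg[OF cd(2) bool])+
      then have ev: "eval W verdict s2 = Some (of_bool ?v)"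
        using distinct_card[OF dist(1)] by (simp add: meets_C1_D1_def)
      \<comment> \<open>With D equal to \<open>set zs\<close>, the clause of
        \<open>search_inv\<close> about D is closedness, and the clause about all S is
        minimality.\<close>
      have "R \<subseteq> set zs" "fits_closed (set zs)" "\<forall>S. R \<subseteq> S \<and> fits_closed S \<longrightarrow> set zs \<subseteq> S"
        using J unfolding search_inv_def fits_closed_def by blast+
      then have Q: "?Q (s2\<lparr>regs := (regs s2)(0 := of_bool ?v)\<rparr>)"
        using dist(2) marks by (intro exI[of _ "set zs"]) simp
      show ?case
        by (rule runs_Assign[OF ev]) (rule Q, simp add: verdict_def)
    qed simp_all
  qed simp
next
  \<comment> \<open>These two bounds absorb the linear and constant terms into the quadratic
    one.\<close>
  have "3 * n \<le> n * n" "3 * 3 \<le> n * n" using n by (intro mult_mono; simp)+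
  moreover have "n * (n * 400 + 120) = 400 * (n * n) + 120 * n" by (simp add: algebra_simps)
  ultimately show "n * 100 + 10 + (n * (n * 400 + 120) + 60) \<le> 1000 * n\<^sup>2"
    unfolding power2_eq_square by linarith
qed

end

section \<open>Correctness on trigraphs\<close>

text \<open>This makes words below the cube of n large enough for every address; n is at least 4
  because R0 has four elements.\<close>

lemma less_cube:
  assumes "4 \<le> (n::nat)"
  shows "n * n + 2 * n < n ^ 3"
proof -
  have "4 * n \<le> n * n" "4 * (n * n) \<le> n * (n * n)" using assms by (intro mult_right_mono; simp)+
  moreover have "n ^ 3 = n * (n * n)" by (simp add: power3_eq_cube)
  ultimately show ?thesis using assms by linarith
qed

text \<open>The search result K is carried over to X, its image under the numbering, and the two
  characterisations of compatible sets are applied to X.\<close>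

lemma closure_program_correct:
  fixes T :: "'a trigraph"
  assumes T: "trigraph T" and nu: "bij_betw \<nu> {..<card (verts T)} (verts T)"
    and proper: "proper T (a1, b1, a2, b2)"
    and R0: "R0 \<subseteq> verts T" "card R0 \<ge> 4" "R0 \<inter> {a1, b1, a2, b2} = {a1, b1}"
  shows "\<exists>t s. exec (card (verts T) ^ 3) closure_program (input_state T \<nu> (a1, b1, a2, b2) R0) t s \<and>
     t \<le> 1000 * (card (verts T))\<^sup>2 \<and>
     ((regs s 0 = 1 \<and>
       (let X = output_set T \<nu> s in
          weak_fragment T X \<and> compatible T (a1, b1, a2, b2) X \<and> R0 \<subseteq> X \<and>
          (\<forall>X'. weak_fragment T X' \<and> compatible T (a1, b1, a2, b2) X' \<and> R0 \<subseteq> X' \<longrightarrow>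
             X \<subseteq> X'))) \<or>
      (regs s 0 = 0 \<and>
       \<not> (\<exists>X. weak_fragment T X \<and> compatible T (a1, b1, a2, b2) X \<and> R0 \<subseteq> X)))"
proof -
  define n where "n = card (verts T)"
  define M where "M = (\<lambda>i j. matrix_entry T (\<nu> i) (\<nu> j))"
  define num where "num = inv_into {..<n} \<nu>"
  define R where "R = {i. i < n \<and> \<nu> i \<in> R0}"
  have fin: "finite (verts T)" using T by (simp add: trigraph_def)
  have n4: "4 \<le> n" using card_mono[OF fin R0(1)] R0(2) by (simp add: n_def)
  have bij: "bij_betw \<nu> {..<n} (verts T)" using nu by (simp add: n_def)
  then have inj: "inj_on \<nu> {..<n}" and img: "\<nu> ` {..<n} = verts T"
    by (simp_all add: bij_betw_def)
  have nuV: "\<nu> i \<in> verts T" if "i < n" for i using img that by blast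
  have num: "num v < n" "\<nu> (num v) = v" if "v \<in> verts T" for v
  proof -
    have "v \<in> \<nu> ` {..<n}" using that img by simp
    then show "num v < n" "\<nu> (num v) = v"
      unfolding num_def using inv_into_into[of v \<nu> "{..<n}"] by (simp_all add: f_inv_into_f)
  qed
  have V: "a1 \<in> verts T" "b1 \<in> verts T" "a2 \<in> verts T" "b2 \<in> verts T"
    using proper by (simp_all add: proper_def)
  interpret closure_input n "n ^ 3" M "num a1" "num b1" "num a2" "num b2"
  proof
    show "M i j \<le> 2" if "i < n" "j < n" for i j
      using matrix_entry_cases[OF T nuV[OF that(1)] nuV[OF that(2)]] by (auto simp: M_def)
  qed (use n4 num V less_cube in auto)
  let ?s = "input_state T \<nu> (a1, b1, a2, b2) R0"
  have regs: "regs ?s = (\<lambda>r. if r < 5 then [n, num a1, num b1, num a2, num b2] ! r else 0)"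
    and mem: "mem ?s = (\<lambda>c. if c < n * n then matrix_entry T (\<nu> (c div n)) (\<nu> (c mod n))
                   else if c < n * n + n \<and> \<nu> (c - n * n) \<in> R0 then 1 else 0)"
    unfolding input_state_def Let_def n_def num_def by simp_all
  have "mem ?s (i * n + j) = M i j" if "i < n" "j < n" for i j
    using index_less[OF that] that by (simp add: mem M_def)
  then have rep: "represents [] R ?s"
    unfolding represents_def by (auto simp: regs mem R_def numeral_eq_Suc)
  have "R \<subseteq> {..<n}" by (auto simp: R_def)
  from runs_closure_program[OF rep _ _ _ _ this]
  obtain t s K where ex: "exec (n ^ 3) closure_program ?s t s" "t \<le> 1000 * n\<^sup>2"
    and K: "K \<subseteq> {..<n}" "R \<subseteq> K" "fits_closed K" "\<And>S. R \<subseteq> S \<Longrightarrow> fits_closed S \<Longrightarrow> K \<subseteq> S"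
    and out: "\<forall>i<n. mem s (n * n + i) = of_bool (i \<in> K)"
    and verdict: "regs s 0 = of_bool (num a2 \<notin> K \<and> num b2 \<notin> K \<and> card K + 3 < n \<and>
      \<not> meets_C1_D1 M (num a2) (num b2) K)"
    unfolding runs_def by (auto simp: regs)
  define X where "X = \<nu> ` K"
  have Xout: "output_set T \<nu> s = X"
  proof -
    have "i < n \<and> mem s (n * n + i) = 1 \<longleftrightarrow> i \<in> K" for i
      using out K(1) by (cases "i \<in> K") auto
    then show ?thesis
      unfolding output_set_def X_def Let_def n_def[symmetric] by auto
  qed
  have XV: "X \<subseteq> verts T" using K(1) img unfolding X_def by blast
  have cardX: "card X = card K"
    unfolding X_def using inj_on_subset[OF inj K(1)] by (rule card_image)
  have cardVX: "card (verts T - X) = n - card K"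
    using card_Diff_subset[OF finite_subset[OF XV fin] XV] cardX by (simp add: n_def)
  have in_X: "v \<in> X \<longleftrightarrow> num v \<in> K" if "v \<in> verts T" for v
  proof
    assume "v \<in> X"
    then obtain i where "i \<in> K" "v = \<nu> i" unfolding X_def by blast
    then show "num v \<in> K" using K(1) inj_onD[OF inj, of "num v" i] num[OF that] by auto
  next
    assume "num v \<in> K"
    then show "v \<in> X" using num(2)[OF that] unfolding X_def by force
  qed
  have fits_nu: "fits M (num a1) (num b1) (num a2) (num b2) i j \<longleftrightarrow>
      fits (matrix_entry T) a1 b1 a2 b2 (\<nu> i) (\<nu> j)" for i j
    by (simp add: fits_def M_def num V)
  have both_nu: "meets_C1_D1 M (num a2) (num b2) K \<longleftrightarrow> meets_C1_D1 (matrix_entry T) a2 b2 X"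
    by (simp add: meets_C1_D1_def M_def num V X_def)
  have R0X: "R0 \<subseteq> X"
  proof
    fix v assume v: "v \<in> R0"
    then have "v \<in> verts T" using R0(1) by blast
    moreover from this have "num v \<in> R" using v by (simp add: R_def num)
    ultimately show "v \<in> X" using K(2) in_X by blast
  qed
  \<comment> \<open>The numbers of the vertices in a compatible X' form a closed set containing R,
    so they include the least such set K.\<close>
  have min: "X \<subseteq> X'" if X': "compatible T (a1, b1, a2, b2) X'" "R0 \<subseteq> X'" for X'
  proof -
    let ?S = "{i. i < n \<and> \<nu> i \<in> X'}"
    have "fits_closed ?S"
      unfolding fits_closed_def fits_nu using compatible_imp_closed(5)[OF X'(1)] nuV by blast
    moreover have "R \<subseteq> ?S" using X'(2) by (auto simp: R_def)
    ultimately have "K \<subseteq> ?S" using K(4) by blast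
    then show ?thesis unfolding X_def by blast
  qed
  show ?thesis
  proof (cases "num a2 \<notin> K \<and> num b2 \<notin> K \<and> card K + 3 < n \<and> \<not> meets_C1_D1 M (num a2) (num b2) K")
    case True
    have "compatible T (a1, b1, a2, b2) X"
    proof (rule closed_imp_compatible[OF T proper XV])
      show "a1 \<in> X" "b1 \<in> X" using R0(3) R0X by blast+
      show "a2 \<notin> X" "b2 \<notin> X" using True in_X V by blast+
      show "card X \<ge> 4" using card_mono[OF finite_subset[OF XV fin] R0X] R0(2) by simp
      show "card (verts T - X) \<ge> 4" using True cardVX by linarith
      show "\<not> meets_C1_D1 (matrix_entry T) a2 b2 X" using True both_nu by simp
      fix x y assume xy: "x \<in> X" "y \<in> verts T - X"
      then have "x \<in> verts T" "y \<in> verts T" using XV by blast+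
      then show "fits (matrix_entry T) a1 b1 a2 b2 x y"
        using K(3) xy in_X num fits_nu[of "num x" "num y"] unfolding fits_closed_def by fastforce
    qed
    then show ?thesis
      using ex verdict True R0X min compatible_imp_weak_fragment Xout
      unfolding Let_def n_def by (intro exI[of _ t] exI[of _ s]) simp
  next
    case False
    \<comment> \<open>A compatible X' would contain X. Each condition tested by the verdict passes
      from X' to its subset X, so the verdict would have been positive.\<close>
    have "\<not> compatible T (a1, b1, a2, b2) X'" if "R0 \<subseteq> X'" for X'
    proof
      assume c: "compatible T (a1, b1, a2, b2) X'"
      note cl = compatible_imp_closed[OF c]
      have sub: "X \<subseteq> X'" using min[OF c that] .
      then have "card (verts T - X') \<le> card (verts T - X)"
        using fin by (intro card_mono) auto
      then have "card K + 3 < n" using cl(4) cardVX by simp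
      moreover have "\<not> meets_C1_D1 (matrix_entry T) a2 b2 X"
        using cl(6) sub unfolding meets_C1_D1_def by blast
      moreover have "a2 \<notin> X" "b2 \<notin> X" using cl(2,3) sub by blast+
      ultimately show False using False both_nu in_X V by blast
    qed
    moreover have "regs s 0 = 0" using verdict False by simp
    ultimately show ?thesis
      using ex unfolding n_def by (intro exI[of _ t] exI[of _ s]) blast
  qed
qed

theorem theorem10p2:
  "\<exists>P k time. (\<lambda>n::nat. real (time n)) \<in> O(\<lambda>n. real n ^ 2) \<and>
     (\<forall>(T :: 'a trigraph) \<nu> a1 b1 a2 b2 R0.
        trigraph T \<and> bij_betw \<nu> {..<card (verts T)} (verts T) \<and>
        proper T (a1, b1, a2, b2) \<and>
        R0 \<subseteq> verts T \<and> card R0 \<ge> 4 \<and> R0 \<inter> {a1, b1, a2, b2} = {a1, b1} \<longrightarrow>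
        (\<exists>t s. exec (card (verts T) ^ k) P (input_state T \<nu> (a1, b1, a2, b2) R0) t s \<and>
           t \<le> time (card (verts T)) \<and>
           ((regs s 0 = 1 \<and>
             (let X = output_set T \<nu> s in
                weak_fragment T X \<and> compatible T (a1, b1, a2, b2) X \<and> R0 \<subseteq> X \<and>
                (\<forall>X'. weak_fragment T X' \<and> compatible T (a1, b1, a2, b2) X' \<and> R0 \<subseteq> X' \<longrightarrow>
                   X \<subseteq> X'))) \<or>
            (regs s 0 = 0 \<and>
             \<not> (\<exists>X. weak_fragment T X \<and> compatible T (a1, b1, a2, b2) X \<and> R0 \<subseteq> X)))))"
\<comment> \<open>The witnesses are left schematic: the first goal fixes the time bound, and
  \<open>closure_program_correct\<close> fixes the program and k = 3.\<close>
proof (intro exI conjI)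
  show "(\<lambda>n::nat. real (1000 * n\<^sup>2)) \<in> O(\<lambda>n. real n ^ 2)"
    by (intro bigoI[where c = 1000]) simp
qed (intro allI impI, elim conjE, rule closure_program_correct)

end
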